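(* Let $n\ge1$ and let $\mu$ be a regular Borel probability measure on the Borel subsets of $[0,1]^n$. Then the map $s:\mathcal{F}_{\mathbb{P}}(n)\to[0,1]$ defined by $s(f)=\int_{[0,1]^n} f\,{\rm d}\mu$ is a state of $\mathcal{F}_{\mathbb{P}}(n)$.
   Context: The standard product algebra $[0,1]_\Pi$ is $[0,1]$ with $x\odot y=xy$, $x\to y=1$ if $x\le y$ and $x\to y=y/x$ otherwise, $\wedge=\min$, $\vee=\max$, and constants $0,1$; put $\neg x:=x\to 0$. For $n\ge1$, $\mathcal{F}_{\mathbb{P}}(n)$ denotes the free $n$-generated product algebra, realized as the subalgebra of $[0,1]^{[0,1]^n}$ (pointwise operations) generated by the projections $\pi_1,\dots,\pi_n$; its elements are functions $[0,1]^n\to[0,1]$, ordered pointwise, and $0,1$ denote the constant functions. A state of $\mathcal{F}_{\mathbb{P}}(n)$ is a map $s:\mathcal{F}_{\mathbb{P}}(n)\to[0,1]$ such that: (S1) $s(1)=1$, $s(0)=0$; (S2) $s(f\wedge g)+s(f\vee g)=s(f)+s(g)$; (S3) $f\le g$ implies $s(f)\le s(g)$; (S4) if $f\neq0$ and $s(f)=0$ then $s(\neg\neg f)=0$. *)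

theory Defs
  imports "HOL-Probability.Probability"
begin

definition unit_cube :: "(real ^ 'n) set" where
  "unit_cube = {x. \<forall>i. x $ i \<in> {0..1}}"

definition prod_imp :: "real \<Rightarrow> real \<Rightarrow> real" where
  "prod_imp a b = (if a \<le> b then 1 else b / a)"

text \<open>
  Functions on the cube \<open>[0,1]\<^sup>n\<close> with \<open>n = CARD('n)\<close> are represented by HOL functions on
  \<^typ>\<open>real ^ 'n\<close> that are \<^const>\<open>undefined\<close> outside \<^const>\<open>unit_cube\<close>. Hence HOL equality of
  two such functions is equality on the cube.
\<close>

definition f_zero :: "real ^ 'n \<Rightarrow> real" where
  "f_zero = (\<lambda>x\<in>unit_cube. 0)"

definition f_one :: "real ^ 'n \<Rightarrow> real" where
  "f_one = (\<lambda>x\<in>unit_cube. 1)"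

definition f_proj :: "'n \<Rightarrow> real ^ 'n \<Rightarrow> real" where
  "f_proj i = (\<lambda>x\<in>unit_cube. x $ i)"

definition f_mult :: "(real ^ 'n \<Rightarrow> real) \<Rightarrow> (real ^ 'n \<Rightarrow> real) \<Rightarrow> real ^ 'n \<Rightarrow> real" where
  "f_mult f g = (\<lambda>x\<in>unit_cube. f x * g x)"

definition f_imp :: "(real ^ 'n \<Rightarrow> real) \<Rightarrow> (real ^ 'n \<Rightarrow> real) \<Rightarrow> real ^ 'n \<Rightarrow> real" where
  "f_imp f g = (\<lambda>x\<in>unit_cube. prod_imp (f x) (g x))"

definition f_meet :: "(real ^ 'n \<Rightarrow> real) \<Rightarrow> (real ^ 'n \<Rightarrow> real) \<Rightarrow> real ^ 'n \<Rightarrow> real" where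
  "f_meet f g = (\<lambda>x\<in>unit_cube. min (f x) (g x))"

definition f_join :: "(real ^ 'n \<Rightarrow> real) \<Rightarrow> (real ^ 'n \<Rightarrow> real) \<Rightarrow> real ^ 'n \<Rightarrow> real" where
  "f_join f g = (\<lambda>x\<in>unit_cube. max (f x) (g x))"

definition f_neg :: "(real ^ 'n \<Rightarrow> real) \<Rightarrow> real ^ 'n \<Rightarrow> real" where
  "f_neg f = f_imp f f_zero"

definition f_le :: "(real ^ 'n \<Rightarrow> real) \<Rightarrow> (real ^ 'n \<Rightarrow> real) \<Rightarrow> bool" where
  "f_le f g \<longleftrightarrow> (\<forall>x\<in>unit_cube. f x \<le> g x)"

inductive_set free_product_algebra :: "(real ^ 'n \<Rightarrow> real) set" where
  proj: "f_proj i \<in> free_product_algebra"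
| zero: "f_zero \<in> free_product_algebra"
| one:  "f_one \<in> free_product_algebra"
| mult: "f \<in> free_product_algebra \<Longrightarrow> g \<in> free_product_algebra \<Longrightarrow> f_mult f g \<in> free_product_algebra"
| imp:  "f \<in> free_product_algebra \<Longrightarrow> g \<in> free_product_algebra \<Longrightarrow> f_imp f g \<in> free_product_algebra"
| meet: "f \<in> free_product_algebra \<Longrightarrow> g \<in> free_product_algebra \<Longrightarrow> f_meet f g \<in> free_product_algebra"
| join: "f \<in> free_product_algebra \<Longrightarrow> g \<in> free_product_algebra \<Longrightarrow> f_join f g \<in> free_product_algebra"

text \<open>Only the values of \<open>s\<close> on \<^const>\<open>free_product_algebra\<close> matter.\<close>

definition is_state :: "((real ^ 'n \<Rightarrow> real) \<Rightarrow> real) \<Rightarrow> bool" where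
  "is_state s \<longleftrightarrow>
     (\<forall>f\<in>free_product_algebra. s f \<in> {0..1}) \<and>
     s f_one = 1 \<and> s f_zero = 0 \<and>
     (\<forall>f\<in>free_product_algebra. \<forall>g\<in>free_product_algebra.
        s (f_meet f g) + s (f_join f g) = s f + s g) \<and>
     (\<forall>f\<in>free_product_algebra. \<forall>g\<in>free_product_algebra. f_le f g \<longrightarrow> s f \<le> s g) \<and>
     (\<forall>f\<in>free_product_algebra. f \<noteq> f_zero \<longrightarrow> s f = 0 \<longrightarrow> s (f_neg (f_neg f)) = 0)"

text \<open>
  The underlying set of \<open>\<mu>\<close> is the cube itself, so open sets are relatively open; for compact
  sets there is no difference.
\<close>

definition regular_borel_prob_on_cube :: "(real ^ 'n) measure \<Rightarrow> bool" where
  "regular_borel_prob_on_cube \<mu> \<longleftrightarrow>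
     prob_space \<mu> \<and>
     sets \<mu> = sets (restrict_space borel unit_cube) \<and>
     (\<forall>A\<in>sets \<mu>. emeasure \<mu> A = (SUP K\<in>{K. compact K \<and> K \<subseteq> A}. emeasure \<mu> K)) \<and>
     (\<forall>A\<in>sets \<mu>. emeasure \<mu> A =
        (INF U\<in>{U. openin (top_of_set unit_cube) U \<and> A \<subseteq> U}. emeasure \<mu> U))"

end

theory Submission
  imports Defs
begin

text \<open>Every element of the algebra is a Borel function on the cube with values in [0,1], by
  induction on its generation, so it is integrable against a probability measure. Normalization and
  monotonicity are then those of the integral, and (S2) integrates the pointwise identity min + max
  = sum. For (S4), \<open>f_neg (f_neg f)\<close> is the indicator of the set where f is nonzero; a
  nonnegative function with integral 0 vanishes almost everywhere, hence so does this
  indicator.\<close>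

lemma free_product_algebra_range:
  assumes "f \<in> free_product_algebra" "x \<in> unit_cube"
  shows "f x \<in> {0..1}"
  using assms
proof (induction rule: free_product_algebra.induct)
  case (proj i)
  then show ?case by (simp add: f_proj_def unit_cube_def)
next
  case (mult f g)
  then show ?case by (simp add: f_mult_def mult_le_one)
qed (auto simp: f_zero_def f_one_def f_imp_def f_meet_def f_join_def prod_imp_def divide_le_eq)

text \<open>Continuity is not preserved by the generation, since \<open>prod_imp\<close> jumps at
  (0,0): double negation turns a projection into an indicator. Borel measurability is preserved by
  all the operations.\<close>

lemma free_product_algebra_measurable:
  fixes f :: "real ^ 'n \<Rightarrow> real"
  assumes "f \<in> free_product_algebra"
  shows "f \<in> borel_measurable (restrict_space borel unit_cube)" (is "_ \<in> borel_measurable ?M")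
  using assms
proof (induction rule: free_product_algebra.induct)
  case (proj i)
  have "(\<lambda>x::real ^ 'n. x $ i) \<in> borel_measurable ?M"
    by (intro measurable_restrict_space1 borel_measurable_continuous_onI continuous_intros)
  \<comment> \<open>\<open>f_proj i\<close> is \<open>undefined\<close> off the cube, but
    measurability over the restricted space only sees values on the cube, where it is the coordinate
    map. The other cases use the same replacement.\<close>
  then show ?case
    by (rule measurable_cong[THEN iffD1, rotated]) (simp add: f_proj_def space_restrict_space)
next
  case zero
  show ?case
    by (rule measurable_cong[THEN iffD1, of _ "\<lambda>x. 0"]) (simp_all add: f_zero_def space_restrict_space)
next
  case one
  show ?case
    by (rule measurable_cong[THEN iffD1, of _ "\<lambda>x. 1"]) (simp_all add: f_one_def space_restrict_space)
next
  case (mult f g)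
  note [measurable] = mult.IH
  have "(\<lambda>x. f x * g x) \<in> borel_measurable ?M" by measurable
  then show ?case
    by (rule measurable_cong[THEN iffD1, rotated]) (simp add: f_mult_def space_restrict_space)
next
  case (imp f g)
  note [measurable] = imp.IH
  \<comment> \<open>A case split along the measurable set where f \<le> g, with a quotient of
    measurable functions elsewhere.\<close>
  have "(\<lambda>x. prod_imp (f x) (g x)) \<in> borel_measurable ?M"
    unfolding prod_imp_def by measurable
  then show ?case
    by (rule measurable_cong[THEN iffD1, rotated]) (simp add: f_imp_def space_restrict_space)
next
  case (meet f g)
  note [measurable] = meet.IH
  have "(\<lambda>x. min (f x) (g x)) \<in> borel_measurable ?M" by measurable
  then show ?case
    by (rule measurable_cong[THEN iffD1, rotated]) (simp add: f_meet_def space_restrict_space)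
next
  case (join f g)
  note [measurable] = join.IH
  have "(\<lambda>x. max (f x) (g x)) \<in> borel_measurable ?M" by measurable
  then show ?case
    by (rule measurable_cong[THEN iffD1, rotated]) (simp add: f_join_def space_restrict_space)
qed

text \<open>In [0,1] the product negation sends 0 to 1 and every positive value to 0, so applying it
  twice yields the indicator of the nonzero set.\<close>

lemma f_neg_f_neg:
  assumes "f \<in> free_product_algebra" "x \<in> unit_cube"
  shows "f_neg (f_neg f) x = (if f x = 0 then 0 else 1)"
  using free_product_algebra_range[OF assms] assms(2)
  by (auto simp: f_neg_def f_imp_def f_zero_def prod_imp_def)

theorem theorem4p9:
  fixes \<mu> :: "(real ^ 'n) measure"
  assumes "regular_borel_prob_on_cube \<mu>"
  shows "(\<forall>f\<in>free_product_algebra. integrable \<mu> f) \<and> is_state (\<lambda>f. LINT x|\<mu>. f x)"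
proof -
  interpret prob_space \<mu>
    using assms by (simp add: regular_borel_prob_on_cube_def)
  have sets: "sets \<mu> = sets (restrict_space borel unit_cube)"
    using assms by (simp add: regular_borel_prob_on_cube_def)
  \<comment> \<open>Facts known only at points of the cube thereby hold on the whole measure
    space.\<close>
  have space: "space \<mu> = unit_cube"
    using sets_eq_imp_space_eq[OF sets] by (simp add: space_restrict_space)
  have int: "integrable \<mu> f" if "f \<in> free_product_algebra" for f
  proof (rule integrable_const_bound[where B = 1])
    show "AE x in \<mu>. norm (f x) \<le> 1"
      using free_product_algebra_range[OF that] by (intro AE_I2) (simp add: space)
    show "f \<in> borel_measurable \<mu>"
      using free_product_algebra_measurable[OF that] measurable_cong_sets[OF sets refl] by blast
  qed
  have "(LINT x|\<mu>. f x) \<in> {0..1}" if f: "f \<in> free_product_algebra" for f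
  proof -
    have "(LINT x|\<mu>. f x) \<ge> 0"
      using free_product_algebra_range[OF f] by (intro Bochner_Integration.integral_nonneg) (simp add: space)
    moreover have "(LINT x|\<mu>. f x) \<le> (LINT x|\<mu>. 1)"
      using free_product_algebra_range[OF f] by (intro integral_mono int[OF f] integrable_const) (simp add: space)
    ultimately show ?thesis by (simp add: prob_space)
  qed
  moreover have "(LINT x|\<mu>. f_one x) = (LINT x|\<mu>. 1)"
    by (intro Bochner_Integration.integral_cong) (simp_all add: f_one_def space)
  then have "(LINT x|\<mu>. f_one x) = 1"
    by (simp add: prob_space)
  moreover have "(LINT x|\<mu>. f_zero x) = (LINT x|\<mu>. 0)"
    by (intro Bochner_Integration.integral_cong) (simp_all add: f_zero_def space)
  then have "(LINT x|\<mu>. f_zero x) = 0"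
    by simp
  moreover have "(LINT x|\<mu>. f_meet f g x) + (LINT x|\<mu>. f_join f g x) = (LINT x|\<mu>. f x) + (LINT x|\<mu>. g x)"
    if f: "f \<in> free_product_algebra" and g: "g \<in> free_product_algebra" for f g
  proof -
    have "(LINT x|\<mu>. f_meet f g x) + (LINT x|\<mu>. f_join f g x) = (LINT x|\<mu>. f_meet f g x + f_join f g x)"
      by (intro Bochner_Integration.integral_add[symmetric] int free_product_algebra.meet
          free_product_algebra.join f g)
    also have "\<dots> = (LINT x|\<mu>. f x + g x)"
      \<comment> \<open>At each point min and max pick out the two values in some order.\<close>
      by (intro Bochner_Integration.integral_cong) (auto simp: f_meet_def f_join_def space)
    also have "\<dots> = (LINT x|\<mu>. f x) + (LINT x|\<mu>. g x)"
      by (intro Bochner_Integration.integral_add int f g)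
    finally show ?thesis .
  qed
  moreover have "(LINT x|\<mu>. f x) \<le> (LINT x|\<mu>. g x)"
    if "f \<in> free_product_algebra" "g \<in> free_product_algebra" "f_le f g" for f g
    using that by (intro integral_mono int) (auto simp: f_le_def space)
  moreover have "(LINT x|\<mu>. f_neg (f_neg f) x) = 0"
    if f: "f \<in> free_product_algebra" and "(LINT x|\<mu>. f x) = 0" for f
  proof -
    have "AE x in \<mu>. 0 \<le> f x"
      using free_product_algebra_range[OF f] by (intro AE_I2) (simp add: space)
    \<comment> \<open>Nonnegativity rules out cancellation, so a zero integral forces f to vanish
      almost everywhere.\<close>
    then have "AE x in \<mu>. f x = 0"
      using integral_nonneg_eq_0_iff_AE[OF int[OF f]] that(2) by simp
    then have "AE x in \<mu>. f_neg (f_neg f) x = 0"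
      using AE_space by eventually_elim (simp add: f_neg_f_neg[OF f] space)
    then show ?thesis by (rule integral_eq_zero_AE)
  qed
  ultimately show ?thesis
    using int unfolding is_state_def by blast
qed

end
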